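(* Let $H,A,(S_t)_{t\ge0},\alpha,\sigma,\rho,U_0$ be as described in the context, and let $\mathcal{M}\subset H$ be a nonempty finite dimensional $C^1$-submanifold with boundary of $H$ which is closed as a subset of $H$. Let $\epsilon_1,\epsilon_2\ge 0$ be arbitrary, and let $B:\mathcal{M}\to H$ be a mapping. Assume that $$\liminf_{t\downarrow 0}\Big\|\frac{S_th-h}{t}-Bh\Big\|\le\epsilon_1,\quad h\in\mathcal{M},$$ $$d_{T_h\mathcal{M}}(Bh+\alpha(h)-\rho(h))\le\epsilon_2,\quad h\in\mathcal{M}\setminus\partial\mathcal{M},$$ $$d_{(T_h\mathcal{M})_+}(Bh+\alpha(h)-\rho(h))\le\epsilon_2,\quad h\in\partial\mathcal{M},$$ and that for all $j\in\mathbb{N}$: $\sigma^j(h)\in T_h\mathcal{M}$ for $h\in\mathcal{M}\setminus\partial\mathcal{M}$ and $\sigma^j(h)\in T_h\partial\mathcal{M}$ for $h\in\partial\mathcal{M}$. Then $$\liminf_{t\downarrow 0}\frac1t d_{\mathcal{M}}\big(S_th+t(\alpha(h)-\rho(h)+\sigma(h)u)\big)\le\epsilon_1+\epsilon_2\quad\text{for all } h\in\mathcal{M} \text{ and } u\in U_0.$$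
   Context: $\mathbb{R}_+=[0,\infty)$. $H$ is a separable Hilbert space and $A$ generates a $C_0$-semigroup $(S_t)_{t\ge 0}$ on $H$ with $\|S_t\|\le e^{\beta t}$, $t\ge 0$, for some $\beta\in\mathbb{R}_+$. $U$ is a separable Hilbert space, $Q\in L(U)$ is nuclear, self-adjoint and positive definite, with orthonormal basis $\{e_j\}_{j\in\mathbb{N}}$ of $U$ and $\lambda_j>0$, $\sum_j\lambda_j<\infty$, $Qe_j=\lambda_je_j$. $U_0:=Q^{1/2}(U)$ has inner product $\langle u,v\rangle_{U_0}=\langle Q^{-1/2}u,Q^{-1/2}v\rangle_U$ and orthonormal basis $g_j:=\sqrt{\lambda_j}e_j$; $L_2^0(H)$ is the space of Hilbert-Schmidt operators from $U_0$ to $H$. The maps $\alpha:H\to H$ and $\sigma:H\to L_2^0(H)$ are Lipschitz continuous, and $\sigma^j:=\sigma(\cdot)g_j\in C_b^2(H)$ for each $j$ (twice continuously differentiable, bounded with bounded first and second derivatives). With $\kappa_{j,1}:=\sup_h\|\sigma^j(h)\|$, $\kappa_{j,2}:=\sup_h\|D\sigma^j(h)\|$, $\kappa_{j,3}:=\sup_h\|D^2\sigma^j(h)\|$ and $L_j:=\frac12(\kappa_{j,2}^2+\kappa_{j,1}\kappa_{j,3})$, assume $\sum_{j}L_j<\infty$, and assume that for each $h\in H$ the limit $\rho(h):=\lim_{r\to\infty}\frac12\sum_{j=1}^rD\sigma^j(h)\sigma^j(h)$ exists. For a nonempty set $C\subset H$, $d_C(x):=\inf_{y\in C}\|x-y\|$.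 $\mathcal{M}\subset H$ is an $m$-dimensional $C^1$-submanifold with boundary if for each $h\in\mathcal{M}$ there are a relatively open subset $V\subset\mathbb{R}_+\times\mathbb{R}^{m-1}$, an open neighborhood $U\subset H$ of $h$ and a map $\phi\in C^1(V;H)$ ($C^1$ up to the boundary points of $V$) such that $\phi:V\to U\cap\mathcal{M}$ is a homeomorphism and $D\phi(y)\in L(\mathbb{R}^m,H)$ is one-to-one for all $y\in V$; $\phi$ is called a local parametrization around $h$. With $\partial V=\{y\in V:y_1=0\}$, the boundary $\partial\mathcal{M}$ is the set of $h\in\mathcal{M}$ with $\phi^{-1}(h)\in\partial V$ for some local parametrization $\phi$ around $h$. With $y=\phi^{-1}(h)$: the tangent space is $T_h\mathcal{M}=D\phi(y)\mathbb{R}^m$, and for $h\in\partial\mathcal{M}$, $(T_h\mathcal{M})_+=D\phi(y)(\mathbb{R}_+\times\mathbb{R}^{m-1})$ and $T_h\partial\mathcal{M}=D\phi(y)(\{0\}\times\mathbb{R}^{m-1})$; these are independent of the parametrization. *)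

theory Defs
  imports "HOL-Analysis.Analysis"
begin

subsection \<open>Strongly continuous semigroups\<close>

definition C0_semigroup :: "(real \<Rightarrow> ('h::real_normed_vector \<Rightarrow>\<^sub>L 'h)) \<Rightarrow> bool" where
  "C0_semigroup S \<longleftrightarrow>
     S 0 = id_blinfun \<and>
     (\<forall>s\<ge>0. \<forall>t\<ge>0. S (s + t) = S s o\<^sub>L S t) \<and>
     (\<forall>h. ((\<lambda>t. S t h) \<longlongrightarrow> h) (at_right 0))"

text \<open>The (unbounded) generator is given by a domain \<open>DA\<close> and a map \<open>A\<close> whose values
  outside \<open>DA\<close> are irrelevant.\<close>

definition generates_C0 ::
    "('h::real_normed_vector \<Rightarrow> 'h) \<Rightarrow> 'h set \<Rightarrow> (real \<Rightarrow> ('h \<Rightarrow>\<^sub>L 'h)) \<Rightarrow> bool" where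
  "generates_C0 A DA S \<longleftrightarrow>
     C0_semigroup S \<and>
     DA = {h. \<exists>l. ((\<lambda>t. (S t h - h) /\<^sub>R t) \<longlongrightarrow> l) (at_right 0)} \<and>
     (\<forall>h\<in>DA. ((\<lambda>t. (S t h - h) /\<^sub>R t) \<longlongrightarrow> A h) (at_right 0))"

subsection \<open>Covariance operators and Hilbert-Schmidt operators\<close>

definition self_adjoint_op :: "('u::real_inner \<Rightarrow>\<^sub>L 'u) \<Rightarrow> bool" where
  "self_adjoint_op T \<longleftrightarrow> (\<forall>x y. T x \<bullet> y = x \<bullet> T y)"

definition nuclear_op :: "('a::real_normed_vector \<Rightarrow>\<^sub>L 'b::real_normed_vector) \<Rightarrow> bool" where
  "nuclear_op T \<longleftrightarrow>
     (\<exists>(b :: nat \<Rightarrow> 'b) (f :: nat \<Rightarrow> ('a \<Rightarrow>\<^sub>L real)).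
        summable (\<lambda>k. norm (b k) * norm (f k)) \<and> (\<forall>x. (\<lambda>k. blinfun_apply (f k) x *\<^sub>R b k) sums T x))"

definition positive_definite_op :: "('u::real_inner \<Rightarrow>\<^sub>L 'u) \<Rightarrow> bool" where
  "positive_definite_op T \<longleftrightarrow> (\<forall>x. x \<noteq> 0 \<longrightarrow> T x \<bullet> x > 0)"

text \<open>\<open>R\<close> is the nonnegative self-adjoint square root \<open>Q\<^sup>1\<^sup>/\<^sup>2\<close> of \<open>Q\<close>; it is unique.\<close>

definition is_sqrt_op :: "('u::real_inner \<Rightarrow>\<^sub>L 'u) \<Rightarrow> ('u \<Rightarrow>\<^sub>L 'u) \<Rightarrow> bool" where
  "is_sqrt_op R Q \<longleftrightarrow> self_adjoint_op R \<and> (\<forall>x. R x \<bullet> x \<ge> 0) \<and> R o\<^sub>L R = Q"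

definition orthonormal_basis :: "(nat \<Rightarrow> 'u::real_inner) \<Rightarrow> bool" where
  "orthonormal_basis e \<longleftrightarrow>
     (\<forall>i j. e i \<bullet> e j = (if i = j then 1 else 0)) \<and> closure (span (range e)) = UNIV"

text \<open>In the next definitions \<open>R\<close> stands for \<open>Q\<^sup>1\<^sup>/\<^sup>2\<close>, which is injective when \<open>Q\<close> is positive
  definite.\<close>

definition U0 :: "('u::real_inner \<Rightarrow>\<^sub>L 'u) \<Rightarrow> 'u set" where
  "U0 R = range (blinfun_apply R)"

definition U0_inner :: "('u::real_inner \<Rightarrow>\<^sub>L 'u) \<Rightarrow> 'u \<Rightarrow> 'u \<Rightarrow> real" where
  "U0_inner R u v = inv (blinfun_apply R) u \<bullet> inv (blinfun_apply R) v"

definition U0_norm :: "('u::real_inner \<Rightarrow>\<^sub>L 'u) \<Rightarrow> 'u \<Rightarrow> real" where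
  "U0_norm R u = sqrt (U0_inner R u u)"

text \<open>Hilbert-Schmidt operators from \<open>U0 R\<close> to \<open>'h\<close>, where \<open>g\<close> is an orthonormal basis of
  \<open>U0 R\<close>.  As \<open>U0 R\<close> is not a type, an operator is a function on \<open>'u\<close> whose values outside
  \<open>U0 R\<close> are irrelevant.\<close>

definition L20 :: "('u::real_inner \<Rightarrow>\<^sub>L 'u) \<Rightarrow> (nat \<Rightarrow> 'u) \<Rightarrow> ('u \<Rightarrow> 'h::real_normed_vector) set" where
  "L20 R g = {T.
     (\<forall>u\<in>U0 R. \<forall>v\<in>U0 R. T (u + v) = T u + T v) \<and>
     (\<forall>c. \<forall>u\<in>U0 R. T (c *\<^sub>R u) = c *\<^sub>R T u) \<and>
     (\<exists>K. \<forall>u\<in>U0 R. norm (T u) \<le> K * U0_norm R u) \<and>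
     summable (\<lambda>j. (norm (T (g j)))\<^sup>2)}"

definition L20_norm :: "(nat \<Rightarrow> 'u) \<Rightarrow> ('u \<Rightarrow> 'h::real_normed_vector) \<Rightarrow> real" where
  "L20_norm g T = sqrt (\<Sum>j. (norm (T (g j)))\<^sup>2)"

definition L20_lipschitz :: "(nat \<Rightarrow> 'u) \<Rightarrow> ('h::real_normed_vector \<Rightarrow> 'u \<Rightarrow> 'h) \<Rightarrow> bool" where
  "L20_lipschitz g \<sigma> \<longleftrightarrow>
     (\<exists>L\<ge>0. \<forall>h k. L20_norm g (\<lambda>u. \<sigma> h u - \<sigma> k u) \<le> L * norm (h - k))"

subsection \<open>The class of bounded twice continuously differentiable maps\<close>

text \<open>The Frechet derivative as a bounded operator, so that \<open>fderiv (fderiv f)\<close> is the second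
  derivative and its norm is that of the associated bilinear map.\<close>

definition fderiv ::
    "('a::real_normed_vector \<Rightarrow> 'b::real_normed_vector) \<Rightarrow> 'a \<Rightarrow> ('a \<Rightarrow>\<^sub>L 'b)" where
  "fderiv f x = Blinfun (frechet_derivative f (at x))"

definition Cb2 :: "('a::real_normed_vector \<Rightarrow> 'b::real_normed_vector) \<Rightarrow> bool" where
  "Cb2 f \<longleftrightarrow>
     (\<forall>x. f differentiable (at x)) \<and>
     (\<forall>x. fderiv f differentiable (at x)) \<and>
     continuous_on UNIV (fderiv (fderiv f)) \<and>
     bounded (range f) \<and> bounded (range (fderiv f)) \<and> bounded (range (fderiv (fderiv f)))"

subsection \<open>Submanifolds with boundary\<close>

text \<open>The dimension is \<open>m = CARD('m) \<ge> 1\<close>, and \<open>i1 :: 'm\<close> is the index of the coordinate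
  that is written \<open>y\<^sub>1\<close> in the usual notation; \<open>halfspace i1\<close> is the half space
  \<open>[0,\<infinity>) \<times> \<real>\<^sup>m\<^sup>-\<^sup>1\<close>.\<close>

definition halfspace :: "'m::finite \<Rightarrow> (real^'m) set" where
  "halfspace i1 = {y. 0 \<le> y $ i1}"

definition bdry_hyperplane :: "'m::finite \<Rightarrow> (real^'m) set" where
  "bdry_hyperplane i1 = {y. y $ i1 = 0}"

text \<open>\<open>\<phi>\<close> is a local parametrization of \<open>M\<close> around \<open>h\<close> with domain \<open>V\<close> and derivative \<open>D\<close>.
  Derivatives are taken within \<open>V\<close>; since \<open>V\<close> is relatively open in the half space,
  \<open>D\<close> is determined by \<open>\<phi>\<close> on \<open>V\<close>, also at the boundary points.\<close>

definition local_param ::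
    "'m::finite \<Rightarrow> 'h::real_normed_vector set \<Rightarrow> 'h \<Rightarrow> (real^'m) set \<Rightarrow> (real^'m \<Rightarrow> 'h) \<Rightarrow>
      (real^'m \<Rightarrow> ((real^'m) \<Rightarrow>\<^sub>L 'h)) \<Rightarrow> bool" where
  "local_param i1 M h V \<phi> D \<longleftrightarrow>
     openin (top_of_set (halfspace i1)) V \<and>
     (\<forall>y\<in>V. (\<phi> has_derivative blinfun_apply (D y)) (at y within V)) \<and>
     continuous_on V D \<and>
     (\<exists>W \<psi>. open W \<and> h \<in> W \<and> homeomorphism V (W \<inter> M) \<phi> \<psi>) \<and>
     (\<forall>y\<in>V. inj (blinfun_apply (D y)))"

definition C1_submanifold :: "'m::finite \<Rightarrow> 'h::real_normed_vector set \<Rightarrow> bool" where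
  "C1_submanifold i1 M \<longleftrightarrow> (\<forall>h\<in>M. \<exists>V \<phi> D. local_param i1 M h V \<phi> D)"

definition mbdry :: "'m::finite \<Rightarrow> 'h::real_normed_vector set \<Rightarrow> 'h set" where
  "mbdry i1 M = {h \<in> M. \<exists>V \<phi> D y.
     local_param i1 M h V \<phi> D \<and> y \<in> V \<and> \<phi> y = h \<and> y \<in> bdry_hyperplane i1}"

text \<open>The image of \<open>C\<close> under \<open>D\<phi>(y)\<close>, \<open>y = \<phi>\<^sup>-\<^sup>1(h)\<close>, for all local parametrizations around \<open>h\<close>.
  In the three instances below this image does not depend on the parametrization (in the last
  two for boundary points \<open>h\<close>), so the union is the common value.\<close>

definition param_image ::
    "'m::finite \<Rightarrow> 'h::real_normed_vector set \<Rightarrow> 'h \<Rightarrow> (real^'m) set \<Rightarrow> 'h set" where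
  "param_image i1 M h C = \<Union> {blinfun_apply (D y) ` C |
     V \<phi> D y. local_param i1 M h V \<phi> D \<and> y \<in> V \<and> \<phi> y = h}"

definition tangent_space :: "'m::finite \<Rightarrow> 'h::real_normed_vector set \<Rightarrow> 'h \<Rightarrow> 'h set" where
  "tangent_space i1 M h = param_image i1 M h UNIV"

definition tangent_halfspace :: "'m::finite \<Rightarrow> 'h::real_normed_vector set \<Rightarrow> 'h \<Rightarrow> 'h set" where
  "tangent_halfspace i1 M h = param_image i1 M h (halfspace i1)"

definition tangent_bdry :: "'m::finite \<Rightarrow> 'h::real_normed_vector set \<Rightarrow> 'h \<Rightarrow> 'h set" where
  "tangent_bdry i1 M h = param_image i1 M h (bdry_hyperplane i1)"

end

theory Submission
  imports Defs
begin

text \<open>The image \<open>K\<close> of the inward directions under \<open>D\<phi>(y)\<close> is the contingent cone of \<open>M\<close> at \<open>h\<close>, whatever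
  the parametrization; it is symmetric exactly at interior points.  Since \<open>\<sigma>(h)Q\<^sup>1\<^sup>/\<^sup>2\<close> is bounded and
  linear and maps the \<open>e\<^sub>j\<close> into the closed lineality space of \<open>K\<close>, adding \<open>\<sigma>(h)u\<close> maps \<open>K\<close> to itself, so
  \<open>Bh + \<alpha>(h) - \<rho>(h) + \<sigma>(h)u\<close> is, up to \<open>\<epsilon>\<^sub>2\<close>, the velocity at \<open>0\<close> of a curve \<open>\<phi>(y + tx)\<close> in \<open>M\<close>.  Comparing
  with the point of this curve at time \<open>t\<close> bounds the distance to \<open>M\<close>; only \<open>S\<^sub>t h - h - tBh\<close>
  contributes the further \<open>\<epsilon>\<^sub>1\<close>.\<close>

section \<open>Lower bounds for injective linear maps\<close>

text \<open>On the compact unit sphere the norm of \<open>f\<close> attains a minimum, positive by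
  injectivity; homogeneity does the rest.\<close>

lemma linear_inj_bounded_below_pos_euclidean:
  fixes f :: "'a::euclidean_space \<Rightarrow> 'b::real_normed_vector"
  assumes f: "bounded_linear f" and inj: "inj f"
  obtains c where "c > 0" "\<And>x. c * norm x \<le> norm (f x)"
proof (cases "sphere (0::'a) 1 = {}")
  case True
  have "x = 0" for x :: 'a
  proof (rule ccontr)
    assume "x \<noteq> 0"
    then have "x /\<^sub>R norm x \<in> sphere 0 1" by simp
    with True show False by blast
  qed
  then have "\<And>x. 1 * norm x \<le> norm (f x)" by (metis norm_ge_zero norm_zero mult_1)
  then show ?thesis using that[of 1] by simp
next
  case False
  interpret f: bounded_linear f by (fact f)
  obtain z where z: "z \<in> sphere 0 1" "\<And>x. x \<in> sphere 0 1 \<Longrightarrow> norm (f z) \<le> norm (f x)"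
    using continuous_attains_inf[of "sphere 0 1" "\<lambda>x. norm (f x)"] False
      continuous_on_norm[OF f.continuous_on[OF continuous_on_id]] by auto
  show ?thesis
  proof (rule that)
    have "f z \<noteq> f 0" using z inj by (metis injD mem_sphere_0 norm_zero zero_neq_one)
    then show "norm (f z) > 0" by simp
    fix x
    show "norm (f z) * norm x \<le> norm (f x)"
    proof (cases "x = 0")
      case False
      then have "norm (f z) \<le> norm (f (x /\<^sub>R norm x))" by (intro z) simp
      then show ?thesis using False by (simp add: f.scaleR field_simps)
    qed simp
  qed
qed

section \<open>Contingent cones and parametrizations\<close>

text \<open>Bouligand's cone in sequential form. No parametrization enters, so it can serve to
  compare two of them.\<close>

definition contingent_cone :: "'h::real_normed_vector set \<Rightarrow> 'h \<Rightarrow> 'h set" where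
  "contingent_cone M h = {v. \<exists>c s. (\<forall>n. c n \<in> M) \<and> (\<forall>n::nat. s n > 0) \<and> s \<longlonglongrightarrow> (0::real) \<and>
     (\<lambda>n. (c n - h) /\<^sub>R s n) \<longlonglongrightarrow> v}"

text \<open>For \<open>y\<close> in the half space: the directions in which a ray from
  \<open>y\<close> stays in the half space for a short time.\<close>

definition inward_directions :: "'m::finite \<Rightarrow> real^'m \<Rightarrow> (real^'m) set" where
  "inward_directions i1 y = (if y $ i1 = 0 then halfspace i1 else UNIV)"

lemma local_paramE:
  assumes "local_param i1 M h V \<phi> D" "h \<in> M"
  obtains y where "y \<in> V" "\<phi> y = h"
proof -
  obtain W \<psi> where "h \<in> W" "homeomorphism V (W \<inter> M) \<phi> \<psi>"
    using assms(1) unfolding local_param_def by blast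
  with assms(2) show thesis
    using that[of "\<psi> h"] unfolding homeomorphism_def by blast
qed

lemma local_param_in_halfspace:
  assumes "local_param i1 M h V \<phi> D" "y \<in> V"
  shows "y $ i1 \<ge> 0"
proof -
  have "V \<subseteq> halfspace i1"
    using assms unfolding local_param_def by (meson openin_imp_subset)
  with assms show ?thesis by (auto simp: halfspace_def)
qed

text \<open>Since \<open>V\<close> is open relative to the half space, a ray in an inward direction
  starts out inside \<open>V\<close>, where the derivative within \<open>V\<close> applies to it,
  also at boundary points.\<close>

lemma local_param_curve:
  fixes M :: "'h::real_normed_vector set" and y x :: "real^'m::finite"
  assumes lp: "local_param i1 M h V \<phi> D" and y: "y \<in> V" and x: "x \<in> inward_directions i1 y"
  shows "\<forall>\<^sub>F t in at_right 0. \<phi> (y + t *\<^sub>R x) \<in> M"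
    and "((\<lambda>t. (\<phi> (y + t *\<^sub>R x) - \<phi> y) /\<^sub>R t) \<longlongrightarrow> D y x) (at_right 0)"
proof -
  obtain T where T: "open T" "V = halfspace i1 \<inter> T"
    using lp unfolding local_param_def openin_open by auto
  have lim: "((\<lambda>t. y + t *\<^sub>R x) \<longlongrightarrow> y) (at_right 0)"
    by (auto intro!: tendsto_eq_intros)
  have "\<forall>\<^sub>F t in at_right 0. y + t *\<^sub>R x \<in> T"
    using lim T y by (auto dest: topological_tendstoD)
  moreover have "\<forall>\<^sub>F t in at_right 0. y + t *\<^sub>R x \<in> halfspace i1"
  proof (cases "y $ i1 = 0")
    case True
    with x have "x $ i1 \<ge> 0" by (simp add: inward_directions_def halfspace_def)
    then show ?thesis
      using True by (auto simp: halfspace_def eventually_at_filter)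
  next
    case False
    with local_param_in_halfspace[OF lp y] have "y $ i1 > 0" by simp
    with lim have "\<forall>\<^sub>F t in at_right 0. (y + t *\<^sub>R x) $ i1 > 0"
      using order_tendstoD(1)[OF tendsto_vec_nth] by blast
    then show ?thesis
      by eventually_elim (simp add: halfspace_def)
  qed
  ultimately have inV: "\<forall>\<^sub>F t in at_right 0. y + t *\<^sub>R x \<in> V"
    using T by (auto elim: eventually_elim2)
  obtain W \<psi> where "homeomorphism V (W \<inter> M) \<phi> \<psi>"
    using lp unfolding local_param_def by blast
  then have "\<phi> ` V \<subseteq> M" by (auto simp: homeomorphism_def)
  then show "\<forall>\<^sub>F t in at_right 0. \<phi> (y + t *\<^sub>R x) \<in> M"
    by (intro eventually_mono[OF inV]) blast
  have der: "(\<phi> has_derivative D y) (at y within V)"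
    using lp y unfolding local_param_def by blast
  show "((\<lambda>t. (\<phi> (y + t *\<^sub>R x) - \<phi> y) /\<^sub>R t) \<longlongrightarrow> D y x) (at_right 0)"
  proof (rule tendstoI)
    fix r :: real assume r: "r > 0"
    \<comment> \<open>The summand 1 admits \<open>x = 0\<close> and makes the later bound by
      \<open>t * r\<close> strict.\<close>
    then have "r / (norm x + 1) > 0" by (simp add: add_nonneg_pos)
    then obtain d where d: "d > 0" "\<And>z. z \<in> V \<Longrightarrow> norm (z - y) < d \<Longrightarrow>
        norm (\<phi> z - \<phi> y - D y (z - y)) \<le> r / (norm x + 1) * norm (z - y)"
      using der unfolding has_derivative_within_alt by blast
    have "\<forall>\<^sub>F t in at_right 0. norm (y + t *\<^sub>R x - y) < d"
      using tendstoD[OF lim d(1)] by (simp add: dist_norm)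
    moreover have "\<forall>\<^sub>F t::real in at_right 0. t > 0"
      by (rule eventually_at_right_less)
    ultimately show "\<forall>\<^sub>F t in at_right 0. dist ((\<phi> (y + t *\<^sub>R x) - \<phi> y) /\<^sub>R t) (D y x) < r"
      using inV
    proof eventually_elim
      case (elim t)
      have "norm (\<phi> (y + t *\<^sub>R x) - \<phi> y - t *\<^sub>R D y x) \<le> r / (norm x + 1) * (t * norm x)"
        using d(2)[OF elim(3) elim(1)] elim(2) by (simp add: blinfun.scaleR_right)
      also have "\<dots> < t * r"
        using r elim(2) by (simp add: field_simps add_pos_nonneg)
      finally have lt: "norm (\<phi> (y + t *\<^sub>R x) - \<phi> y - t *\<^sub>R D y x) < t * r" .
      have "(\<phi> (y + t *\<^sub>R x) - \<phi> y) /\<^sub>R t - D y x = (\<phi> (y + t *\<^sub>R x) - \<phi> y - t *\<^sub>R D y x) /\<^sub>R t"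
        using elim(2) by (simp add: scaleR_diff_right)
      then have "dist ((\<phi> (y + t *\<^sub>R x) - \<phi> y) /\<^sub>R t) (D y x)
          = norm (\<phi> (y + t *\<^sub>R x) - \<phi> y - t *\<^sub>R D y x) / t"
        using elim(2) by (simp add: dist_norm divide_inverse_commute)
      also have "\<dots> < r" using lt elim(2) by (simp add: field_simps)
      finally show ?case .
    qed
  qed
qed

lemma contingent_coneI:
  fixes c :: "real \<Rightarrow> 'h::real_normed_vector"
  assumes "\<forall>\<^sub>F t in at_right 0. c t \<in> M" "((\<lambda>t. (c t - h) /\<^sub>R t) \<longlongrightarrow> v) (at_right 0)"
  shows "v \<in> contingent_cone M h"
proof -
  obtain b where b: "b > 0" "\<And>t. 0 < t \<Longrightarrow> t < b \<Longrightarrow> c t \<in> M"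
    using assms(1) unfolding eventually_at_right_field by auto
  \<comment> \<open>Halving puts already \<open>s 0\<close> strictly below \<open>b\<close>, so
    every member of the sequence, not only a tail, gives a point of \<open>M\<close>.\<close>
  define s where "s n = b / 2 / real (Suc n)" for n
  have s: "s n > 0" "s n < b" for n
    using b by (auto simp: s_def field_simps add_pos_nonneg)
  have s0: "s \<longlonglongrightarrow> 0"
    unfolding s_def by (intro LIMSEQ_Suc lim_const_over_n)
  then have "filterlim s (at_right 0) sequentially"
    using s(1) by (auto simp: filterlim_at less_imp_neq[symmetric])
  then have "(\<lambda>n. (c (s n) - h) /\<^sub>R s n) \<longlonglongrightarrow> v"
    by (rule filterlim_compose[OF assms(2)])
  with s s0 b(2) show ?thesis
    unfolding contingent_cone_def by (auto intro!: exI[of _ "\<lambda>n. c (s n)"] exI[of _ s])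
qed

text \<open>The inclusion from left to right: along a sequence in \<open>M\<close> with quotients tending to \<open>v\<close>, the
  quotients of the coordinates are bounded since \<open>D y\<close> is bounded below, so they have a limit point
  \<open>x\<close>, and \<open>v = D y x\<close>.\<close>

lemma contingent_cone_eq:
  fixes M :: "'h::real_normed_vector set" and y :: "real^'m::finite"
  assumes lp: "local_param i1 M h V \<phi> D" and y: "y \<in> V" "\<phi> y = h"
  shows "contingent_cone M h = D y ` inward_directions i1 y"
proof
  show "D y ` inward_directions i1 y \<subseteq> contingent_cone M h"
    using contingent_coneI[OF local_param_curve[OF lp y(1), unfolded y(2)]] by blast
  show "contingent_cone M h \<subseteq> D y ` inward_directions i1 y"
  proof
    fix v assume "v \<in> contingent_cone M h"
    then obtain c s where c: "\<And>n. c n \<in> M" and s: "\<And>n::nat. s n > 0" "s \<longlonglongrightarrow> (0::real)"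
      and cv: "(\<lambda>n. (c n - h) /\<^sub>R s n) \<longlonglongrightarrow> v"
      unfolding contingent_cone_def by auto
    obtain W \<psi> where W: "open W" "h \<in> W" and hom: "homeomorphism V (W \<inter> M) \<phi> \<psi>"
      using lp unfolding local_param_def by blast
    have der: "(\<phi> has_derivative D y) (at y within V)" and inj: "inj (D y)"
      using lp y unfolding local_param_def by blast+
    have "bounded_linear (D y)" by (simp add: blinfun.bounded_linear_right)
    then obtain k where k: "k > 0" "\<And>x. k * norm x \<le> norm (D y x)"
      using linear_inj_bounded_below_pos_euclidean inj by blast
    have "(\<lambda>n. s n *\<^sub>R ((c n - h) /\<^sub>R s n)) \<longlonglongrightarrow> 0 *\<^sub>R v"
      by (intro tendsto_scaleR s cv)
    moreover have "s n *\<^sub>R ((c n - h) /\<^sub>R s n) = c n - h" for n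
      using s(1)[of n] by simp
    ultimately have "(\<lambda>n. c n - h) \<longlonglongrightarrow> 0" by simp
    then have ch: "c \<longlonglongrightarrow> h" by (simp add: LIM_zero_iff)
    have cW: "\<forall>\<^sub>F n in sequentially. c n \<in> W \<inter> M"
      using topological_tendstoD[OF ch W] c by simp
    define z where "z n = \<psi> (c n)" for n
    have hM: "h \<in> W \<inter> M" and \<psi>h: "\<psi> h = y"
      using hom y by (auto simp: homeomorphism_def)
    have zV: "\<forall>\<^sub>F n in sequentially. z n \<in> V \<and> \<phi> (z n) = c n"
      using cW hom by (auto simp: z_def homeomorphism_def elim!: eventually_mono)
    have "continuous_on (W \<inter> M) \<psi>" using hom by (simp add: homeomorphism_def)
    then have zy: "z \<longlonglongrightarrow> y"
      unfolding z_def using continuous_on_tendsto_compose[OF _ ch hM cW] \<psi>h by metis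
    define q where "q n = (z n - y) /\<^sub>R s n" for n
    define w where "w n = (c n - h) /\<^sub>R s n" for n
    \<comment> \<open>Differentiability at \<open>y\<close>, applied at \<open>z n\<close> and
      divided by \<open>s n\<close>.\<close>
    have est: "\<forall>\<^sub>F n in sequentially. norm (w n - D y (q n)) \<le> r * norm (q n)" if "r > 0" for r
    proof -
      obtain d where d: "d > 0" "\<And>z. z \<in> V \<Longrightarrow> norm (z - y) < d \<Longrightarrow>
          norm (\<phi> z - \<phi> y - D y (z - y)) \<le> r * norm (z - y)"
        using der \<open>r > 0\<close> unfolding has_derivative_within_alt by blast
      have "\<forall>\<^sub>F n in sequentially. norm (z n - y) < d"
        using tendstoD[OF zy d(1)] by (simp add: dist_norm)
      with zV show ?thesis
      proof eventually_elim
        case (elim n)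
        have "norm (c n - h - D y (z n - y)) \<le> r * norm (z n - y)"
          using d(2)[of "z n"] elim y by auto
        moreover have "w n - D y (q n) = (c n - h - D y (z n - y)) /\<^sub>R s n"
          by (simp add: w_def q_def blinfun.scaleR_right flip: scaleR_diff_right)
        moreover have "norm (q n) = norm (z n - y) / s n"
          using s(1)[of n] by (simp add: q_def divide_inverse_commute)
        ultimately show ?case
          using s(1)[of n] by (simp add: divide_inverse_commute[symmetric] divide_right_mono)
      qed
    qed
    have wv: "w \<longlonglongrightarrow> v" using cv by (simp add: w_def[abs_def])
    have "\<forall>\<^sub>F n in sequentially. norm (w n) < norm v + 1"
      by (rule order_tendstoD(2)[OF tendsto_norm[OF wv]]) simp
    \<comment> \<open>An error of \<open>k/2\<close> times \<open>norm (q n)\<close> can be absorbed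
      into the lower bound \<open>k * norm (q n)\<close>, which leaves a bound on
      \<open>q n\<close>.\<close>
    moreover have "\<forall>\<^sub>F n in sequentially. norm (w n - D y (q n)) \<le> k/2 * norm (q n)"
      by (rule est) (use k in simp)
    ultimately have "\<forall>\<^sub>F n in sequentially. norm (q n) \<le> 2 * (norm v + 1) / k"
    proof eventually_elim
      case (elim n)
      have "k * norm (q n) \<le> norm (D y (q n))" by (rule k)
      also have "\<dots> \<le> norm (w n) + norm (w n - D y (q n))"
        by (metis norm_minus_commute norm_triangle_sub)
      finally show ?case using elim k by (simp add: field_simps)
    qed
    then obtain N where N: "\<And>n. n \<ge> N \<Longrightarrow> norm (q n) \<le> 2 * (norm v + 1) / k"
      by (auto simp: eventually_sequentially)
    then have "bounded (range (\<lambda>n. q (n + N)))"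
      unfolding bounded_iff by (intro exI[of _ "2 * (norm v + 1) / k"]) auto
    then obtain x r where r: "strict_mono r" "((\<lambda>n. q (n + N)) \<circ> r) \<longlonglongrightarrow> x"
      using bounded_imp_convergent_subsequence by blast
    \<comment> \<open>The shift by \<open>N\<close> and the extraction \<open>r\<close> combine into
      one subsequence of \<open>q\<close> itself.\<close>
    define p where "p n = r n + N" for n
    have p: "strict_mono p" using r(1) by (auto simp: p_def strict_mono_def)
    have qx: "(q \<circ> p) \<longlonglongrightarrow> x" using r(2) by (simp add: o_def p_def)
    have "(\<lambda>n. w n - D y (q n)) \<longlonglongrightarrow> 0"
    proof (rule tendstoI)
      fix \<delta> :: real assume "\<delta> > 0"
      define K where "K = 2 * (norm v + 1) / k"
      have K: "K > 0" using k by (simp add: K_def add_nonneg_pos)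
      have "\<forall>\<^sub>F n in sequentially. norm (w n - D y (q n)) \<le> \<delta> / (2 * K) * norm (q n)"
        using est[of "\<delta> / (2 * K)"] K \<open>\<delta> > 0\<close> by simp
      with eventually_ge_at_top[of N]
      show "\<forall>\<^sub>F n in sequentially. dist (w n - D y (q n)) 0 < \<delta>"
      proof eventually_elim
        case (elim n)
        have "\<delta> / (2 * K) * norm (q n) \<le> \<delta> / (2 * K) * K"
          using N[OF elim(1), folded K_def] K \<open>\<delta> > 0\<close> by (intro mult_left_mono) auto
        also have "\<dots> < \<delta>" using K \<open>\<delta> > 0\<close> by simp
        finally show ?case using elim by simp
      qed
    qed
    then have "(\<lambda>n. w n - (w n - D y (q n))) \<longlonglongrightarrow> v - 0"
      by (intro tendsto_diff wv)
    then have "(\<lambda>n. D y (q n)) \<longlonglongrightarrow> v" by simp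
    then have "((\<lambda>n. D y (q n)) \<circ> p) \<longlonglongrightarrow> v" using LIMSEQ_subseq_LIMSEQ p by blast
    moreover have "((\<lambda>n. D y (q n)) \<circ> p) \<longlonglongrightarrow> D y x"
      using blinfun.tendsto[OF tendsto_const qx] by (simp add: o_def)
    ultimately have v: "v = D y x" using LIMSEQ_unique by blast
    \<comment> \<open>From \<open>y\<close> on the hyperplane to \<open>z n\<close> in the half
      space the \<open>i1\<close> coordinate cannot decrease; this sign passes to the limit of the
      quotients.\<close>
    have "x $ i1 \<ge> 0" if "y $ i1 = 0"
    proof -
      have "\<forall>\<^sub>F n in sequentially. q n $ i1 \<ge> 0"
        using zV
      proof eventually_elim
        case (elim n)
        then have "z n $ i1 \<ge> 0" using local_param_in_halfspace[OF lp] by blast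
        then show ?case using that s(1)[of n] by (simp add: q_def)
      qed
      then have "\<forall>\<^sub>F n in sequentially. (q \<circ> p) n $ i1 \<ge> 0"
        unfolding o_def using eventually_subseq[OF p] by blast
      then show ?thesis
        using tendsto_lowerbound[OF tendsto_vec_nth[OF qx]] by simp
    qed
    then show "v \<in> D y ` inward_directions i1 y"
      using v by (auto simp: inward_directions_def halfspace_def)
  qed
qed

text \<open>The witness is the image of the inward normal \<open>axis i1 1\<close>: by injectivity
  its negative could only come from the outward normal.\<close>

lemma contingent_cone_not_symmetric:
  fixes M :: "'h::real_normed_vector set" and y :: "real^'m::finite"
  assumes lp: "local_param i1 M h V \<phi> D" and y: "y \<in> V" "\<phi> y = h" "y $ i1 = 0"
  shows "\<exists>v. v \<in> contingent_cone M h \<and> - v \<notin> contingent_cone M h"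
proof (intro exI conjI)
  have K: "contingent_cone M h = D y ` halfspace i1"
    using contingent_cone_eq[OF lp y(1,2)] y(3) by (simp add: inward_directions_def)
  then show "D y (axis i1 1) \<in> contingent_cone M h" by (auto simp: halfspace_def)
  have inj: "inj (D y)" using lp y unfolding local_param_def by blast
  show "- D y (axis i1 1) \<notin> contingent_cone M h"
  proof
    assume "- D y (axis i1 1) \<in> contingent_cone M h"
    then obtain x where x: "x \<in> halfspace i1" "D y (- axis i1 1) = D y x"
      using K by (auto simp: blinfun.minus_right)
    then have "- axis i1 1 = x" using inj by (auto dest: injD)
    with x(1) show False by (auto simp: halfspace_def)
  qed
qed

lemma contingent_cone_symmetric:
  fixes M :: "'h::real_normed_vector set" and y :: "real^'m::finite"
  assumes lp: "local_param i1 M h V \<phi> D" and y: "y \<in> V" "\<phi> y = h" "y $ i1 \<noteq> 0"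
    and v: "v \<in> contingent_cone M h"
  shows "- v \<in> contingent_cone M h"
proof -
  have "contingent_cone M h = range (D y)"
    using contingent_cone_eq[OF lp y(1,2)] y(3) by (simp add: inward_directions_def)
  with v show ?thesis by (auto simp: blinfun.minus_right[symmetric])
qed

section \<open>Boundary points and tangent spaces\<close>

text \<open>Two parametrizations that disagree would make the same contingent cone both symmetric
  and not symmetric. So any single parametrization decides whether \<open>h\<close> is a boundary
  point.\<close>

lemma mbdry_iff:
  fixes M :: "'h::real_normed_vector set" and y :: "real^'m::finite"
  assumes lp: "local_param i1 M h V \<phi> D" and y: "y \<in> V" "\<phi> y = h" and h: "h \<in> M"
  shows "h \<in> mbdry i1 M \<longleftrightarrow> y $ i1 = 0"
proof
  assume "y $ i1 = 0"
  then show "h \<in> mbdry i1 M"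
    using assms unfolding mbdry_def bdry_hyperplane_def by blast
next
  assume "h \<in> mbdry i1 M"
  then obtain V' \<phi>' D' y' where "local_param i1 M h V' \<phi>' D'" "y' \<in> V'" "\<phi>' y' = h" "y' $ i1 = 0"
    unfolding mbdry_def bdry_hyperplane_def by blast
  then show "y $ i1 = 0"
    using contingent_cone_not_symmetric contingent_cone_symmetric[OF lp y] by metis
qed

text \<open>At an interior point every direction is inward, so each member of the union behind
  \<open>tangent_space\<close> is the contingent cone and the union collapses.\<close>

lemma tangent_space_interior:
  fixes M :: "'h::real_normed_vector set"
  assumes lp: "local_param i1 M h V \<phi> D" and y: "y \<in> V" "\<phi> y = h"
    and h: "h \<in> M - mbdry i1 M"
  shows "tangent_space i1 M h = range (D y)"
proof -
  have "D' y' ` UNIV = contingent_cone M h"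
    if "local_param i1 M h V' \<phi>' D'" "y' \<in> V'" "\<phi>' y' = h" for V' \<phi>' D' y'
    using contingent_cone_eq[OF that] mbdry_iff[OF that] h by (simp add: inward_directions_def)
  from this[OF lp y] this show ?thesis
    unfolding tangent_space_def param_image_def using lp y by blast
qed

lemma tangent_halfspace_boundary:
  fixes M :: "'h::real_normed_vector set"
  assumes lp: "local_param i1 M h V \<phi> D" and y: "y \<in> V" "\<phi> y = h"
    and h: "h \<in> mbdry i1 M"
  shows "tangent_halfspace i1 M h = D y ` halfspace i1"
proof -
  have "h \<in> M" using h by (simp add: mbdry_def)
  then have "D' y' ` halfspace i1 = contingent_cone M h"
    if "local_param i1 M h V' \<phi>' D'" "y' \<in> V'" "\<phi>' y' = h" for V' \<phi>' D' y'
    using contingent_cone_eq[OF that] mbdry_iff[OF that] h by (simp add: inward_directions_def)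
  from this[OF lp y] this show ?thesis
    unfolding tangent_halfspace_def param_image_def using lp y by blast
qed

text \<open>The boundary tangent space is the lineality space of the contingent cone, which does not
  refer to a parametrization.\<close>

lemma tangent_bdry_boundary:
  fixes M :: "'h::real_normed_vector set"
  assumes lp: "local_param i1 M h V \<phi> D" and y: "y \<in> V" "\<phi> y = h"
    and h: "h \<in> mbdry i1 M"
  shows "tangent_bdry i1 M h = D y ` bdry_hyperplane i1"
proof -
  have hM: "h \<in> M" using h by (simp add: mbdry_def)
  have "D' y' ` bdry_hyperplane i1 = {v \<in> contingent_cone M h. - v \<in> contingent_cone M h}"
    if lp': "local_param i1 M h V' \<phi>' D'" "y' \<in> V'" "\<phi>' y' = h" for V' \<phi>' D' y'
  proof -
    have K: "contingent_cone M h = D' y' ` halfspace i1"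
      using contingent_cone_eq[OF lp'] mbdry_iff[OF lp' hM] h by (simp add: inward_directions_def)
    have inj: "inj (D' y')" using lp' unfolding local_param_def by blast
    show ?thesis
    proof (intro set_eqI iffI)
      fix v assume "v \<in> D' y' ` bdry_hyperplane i1"
      then obtain x where x: "v = D' y' x" "x $ i1 = 0" by (auto simp: bdry_hyperplane_def)
      then have "x \<in> halfspace i1" "- x \<in> halfspace i1" "- v = D' y' (- x)"
        by (auto simp: halfspace_def blinfun.minus_right)
      with x K show "v \<in> {v \<in> contingent_cone M h. - v \<in> contingent_cone M h}" by auto
    next
      fix v assume "v \<in> {v \<in> contingent_cone M h. - v \<in> contingent_cone M h}"
      then obtain x x' where x: "v = D' y' x" "x \<in> halfspace i1" "- v = D' y' x'" "x' \<in> halfspace i1"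
        using K by auto
      \<comment> \<open>By injectivity \<open>x\<close> and \<open>x'\<close> are opposite; both lie
        in the half space, so their \<open>i1\<close> coordinate vanishes.\<close>
      then have "D' y' (- x) = D' y' x'" by (simp add: blinfun.minus_right)
      then have "- x = x'" using inj by (auto dest: injD)
      with x show "v \<in> D' y' ` bdry_hyperplane i1"
        by (auto simp: halfspace_def bdry_hyperplane_def)
    qed
  qed
  from this[OF lp y] this show ?thesis
    unfolding tangent_bdry_def param_image_def using lp y by blast
qed

section \<open>The square root of \<open>Q\<close> and Hilbert-Schmidt operators\<close>

text \<open>Factor \<open>R\<^sup>2 - c\<close> as \<open>(R + sqrt c) (R - sqrt c)\<close>: a
  nonzero \<open>f\<close> would be an eigenvector of the nonnegative \<open>R\<close> for the
  eigenvalue \<open>- sqrt c\<close>. This identifies \<open>g j\<close> with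
  \<open>R (e j)\<close>.\<close>

lemma sqrt_op_eigenvector:
  assumes R: "is_sqrt_op R Q" and "Q x = c *\<^sub>R x" "c > 0"
  shows "R x = sqrt c *\<^sub>R x"
proof -
  define f where "f = R x - sqrt c *\<^sub>R x"
  have "R (R x) = c *\<^sub>R x"
    using R assms(2) unfolding is_sqrt_op_def by (metis blinfun_apply_blinfun_compose)
  then have "R f = - sqrt c *\<^sub>R f"
    using \<open>c > 0\<close> by (simp add: f_def blinfun.diff_right blinfun.scaleR_right algebra_simps)
  moreover have "R f \<bullet> f \<ge> 0" using R by (simp add: is_sqrt_op_def)
  ultimately have "sqrt c * (f \<bullet> f) \<le> 0" by simp
  with \<open>c > 0\<close> have "f \<bullet> f \<le> 0" by (simp add: mult_le_0_iff)
  then have "f = 0" by (metis inner_eq_zero_iff inner_ge_zero order_antisym)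
  then show ?thesis by (simp add: f_def)
qed

lemma inj_sqrt_op:
  assumes "is_sqrt_op R Q" "positive_definite_op Q"
  shows "inj (blinfun_apply R)"
proof (rule injI)
  fix x y assume "R x = R y"
  then have "R (x - y) = 0" by (simp add: blinfun.diff_right)
  then have "Q (x - y) = 0"
    using assms(1) unfolding is_sqrt_op_def by (metis blinfun_apply_blinfun_compose blinfun.zero_right)
  then show "x = y"
    using assms(2) unfolding positive_definite_op_def by (metis inner_zero_left less_irrefl right_minus_eq)
qed

text \<open>Operators in \<open>L20\<close> are bounded for \<open>U0_norm\<close>. By injectivity
  \<open>U0_norm R (R x) = norm x\<close>, so composing with \<open>R\<close> gives a map bounded
  for the original norm, in which the span of \<open>e\<close> is dense.\<close>

lemma L20_bounded_linear:
  assumes T: "T \<in> L20 R g" and inj: "inj (blinfun_apply R)"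
  shows "bounded_linear (\<lambda>z. T (R z))"
proof -
  obtain K where K: "\<And>u. u \<in> U0 R \<Longrightarrow> norm (T u) \<le> K * U0_norm R u"
    using T unfolding L20_def by blast
  show ?thesis
  proof (rule bounded_linear_intro)
    show "T (R (x + y)) = T (R x) + T (R y)" for x y
      using T unfolding L20_def U0_def by (auto simp: blinfun.add_right)
    show "T (R (r *\<^sub>R x)) = r *\<^sub>R T (R x)" for r x
      using T unfolding L20_def U0_def by (auto simp: blinfun.scaleR_right)
    show "norm (T (R x)) \<le> norm x * K" for x
      using K[of "R x"] inj
      by (simp add: U0_def U0_norm_def U0_inner_def norm_eq_sqrt_inner[symmetric] mult.commute)
  qed
qed

lemma bounded_linear_range_subset_closed_subspace:
  fixes f :: "'a::real_normed_vector \<Rightarrow> 'b::real_normed_vector"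
  assumes f: "bounded_linear f" and E: "closure (span E) = UNIV"
    and N: "subspace N" "closed N" and fE: "f ` E \<subseteq> N"
  shows "f z \<in> N"
proof -
  interpret f: bounded_linear f by (fact f)
  have "f ` span E = span (f ` E)"
    using linear_span_image[OF f.linear] ..
  then have "f ` span E \<subseteq> N" using fE N(1) by (simp add: span_minimal)
  moreover have "continuous_on (closure (span E)) f" by (rule f.continuous_on) auto
  ultimately have "f ` closure (span E) \<subseteq> N"
    using image_closure_subset N(2) by blast
  then show ?thesis using E by auto
qed

text \<open>A map bounded below preserves completeness. Closedness lets tangency pass from the
  vectors \<open>\<sigma>c j h\<close> to the limits of their linear combinations.\<close>

lemma closed_inj_blinfun_image:
  fixes f :: "'a::euclidean_space \<Rightarrow>\<^sub>L 'b::real_normed_vector"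
  assumes "inj f" "subspace X"
  shows "closed (f ` X)"
proof -
  have bl: "bounded_linear f" by (rule blinfun.bounded_linear_right)
  obtain c where "c > 0" "\<And>x. c * norm x \<le> norm (f x)"
    using linear_inj_bounded_below_pos_euclidean[OF bl assms(1)] by metis
  then have "complete (f ` X)"
    using assms(2) by (intro complete_isometric_image[OF _ _ bl])
      (auto simp: complete_eq_closed closed_subspace)
  then show ?thesis by (rule complete_imp_closed)
qed

lemma subspace_bdry_hyperplane: "subspace (bdry_hyperplane i1)"
  by (auto simp: subspace_def bdry_hyperplane_def)

section \<open>Lower limits and nearly nearest points\<close>

text \<open>Lower limits are not subadditive in general; here only \<open>g\<close> is controlled
  along some \<open>t\<close>, while the excess over \<open>g\<close> is bounded eventually for all
  \<open>t\<close>.\<close>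

lemma Liminf_ereal_le_add:
  fixes f g :: "'a \<Rightarrow> real"
  assumes g: "Liminf F (\<lambda>t. ereal (g t)) \<le> ereal a"
    and f: "\<And>\<delta>. \<delta> > 0 \<Longrightarrow> \<forall>\<^sub>F t in F. f t \<le> g t + b + \<delta>"
  shows "Liminf F (\<lambda>t. ereal (f t)) \<le> ereal (a + b)"
proof (rule ccontr)
  assume "\<not> ?thesis"
  then obtain d where d: "ereal (a + b) < ereal d" "ereal d < Liminf F (\<lambda>t. ereal (f t))"
    by (meson ereal_dense2 not_le)
  \<comment> \<open>Half the gap: \<open>f t > a + b + 2 * \<delta>\<close> and
    \<open>f t \<le> g t + b + \<delta>\<close> leave \<open>g t \<ge> a + \<delta>\<close>.\<close>
  define \<delta> where "\<delta> = (d - a - b) / 2"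
  have "\<delta> > 0" using d(1) by (simp add: \<delta>_def)
  have "\<forall>\<^sub>F t in F. d < f t" using less_LiminfD[OF d(2)] by simp
  with f[OF \<open>\<delta> > 0\<close>] have "\<forall>\<^sub>F t in F. ereal (a + \<delta>) \<le> ereal (g t)"
    by eventually_elim (simp add: \<delta>_def field_simps)
  then have "ereal (a + \<delta>) \<le> Liminf F (\<lambda>t. ereal (g t))" by (rule Liminf_bounded)
  with g have "ereal (a + \<delta>) \<le> ereal a" by (rule order_trans[rotated])
  with \<open>\<delta> > 0\<close> show False by simp
qed

text \<open>Nonemptiness excludes the default value 0 of \<open>infdist\<close> for the empty
  set.\<close>

lemma infdist_close_point:
  assumes "A \<noteq> {}" "infdist x A < r"
  obtains a where "a \<in> A" "dist x a < r"
  using assms by (auto simp: infdist_def cInf_less_iff)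

section \<open>The distance estimate\<close>

theorem proposition5p1:
  fixes A :: "'h::{real_inner, banach, second_countable_topology} \<Rightarrow> 'h"
    and DA :: "'h set"
    and S :: "real \<Rightarrow> ('h \<Rightarrow>\<^sub>L 'h)"
    and \<beta> :: real
    and Q R :: "'u::{real_inner, banach, second_countable_topology} \<Rightarrow>\<^sub>L 'u"
    and e g :: "nat \<Rightarrow> 'u"
    and lam L \<kappa>1 \<kappa>2 \<kappa>3 :: "nat \<Rightarrow> real"
    and \<alpha> \<rho> B :: "'h \<Rightarrow> 'h"
    and \<sigma> :: "'h \<Rightarrow> 'u \<Rightarrow> 'h"
    and \<sigma>c :: "nat \<Rightarrow> 'h \<Rightarrow> 'h"
    and i1 :: "'m::finite"
    and M :: "'h set"
    and \<epsilon>1 \<epsilon>2 :: real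
  assumes generator: "generates_C0 A DA S"
    and beta: "\<beta> \<ge> 0" "\<And>t. t \<ge> 0 \<Longrightarrow> norm (S t) \<le> exp (\<beta> * t)"
    and Q: "nuclear_op Q" "self_adjoint_op Q" "positive_definite_op Q"
    and e: "orthonormal_basis e"
    and lam: "\<And>j. lam j > 0" "summable lam" "\<And>j. Q (e j) = lam j *\<^sub>R e j"
    and R: "is_sqrt_op R Q"
    and g: "\<And>j. g j = sqrt (lam j) *\<^sub>R e j"
    and alpha: "\<exists>C. C-lipschitz_on UNIV \<alpha>"
    and sigma: "\<And>h. \<sigma> h \<in> L20 R g" "L20_lipschitz g \<sigma>"
    and sigmac: "\<And>j h. \<sigma>c j h = \<sigma> h (g j)" "\<And>j. Cb2 (\<sigma>c j)"
    and kappa1: "\<And>j. \<kappa>1 j = (SUP h. norm (\<sigma>c j h))"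
    and kappa2: "\<And>j. \<kappa>2 j = (SUP h. norm (fderiv (\<sigma>c j) h))"
    and kappa3: "\<And>j. \<kappa>3 j = (SUP h. norm (fderiv (fderiv (\<sigma>c j)) h))"
    and L: "\<And>j. L j = 1/2 * ((\<kappa>2 j)\<^sup>2 + \<kappa>1 j * \<kappa>3 j)" "summable L"
    and rho: "\<And>h. (\<lambda>r. (1/2) *\<^sub>R (\<Sum>j<r. fderiv (\<sigma>c j) h (\<sigma>c j h))) \<longlonglongrightarrow> \<rho> h"
    and M: "C1_submanifold i1 M" "M \<noteq> {}" "closed M"
    and eps: "\<epsilon>1 \<ge> 0" "\<epsilon>2 \<ge> 0"
    and B: "\<And>h. h \<in> M \<Longrightarrow>
        Liminf (at_right 0) (\<lambda>t. ereal (norm ((S t h - h) /\<^sub>R t - B h))) \<le> ereal \<epsilon>1"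
    and drift_interior: "\<And>h. h \<in> M - mbdry i1 M \<Longrightarrow>
        infdist (B h + \<alpha> h - \<rho> h) (tangent_space i1 M h) \<le> \<epsilon>2"
    and drift_boundary: "\<And>h. h \<in> mbdry i1 M \<Longrightarrow>
        infdist (B h + \<alpha> h - \<rho> h) (tangent_halfspace i1 M h) \<le> \<epsilon>2"
    and sigma_interior: "\<And>j h. h \<in> M - mbdry i1 M \<Longrightarrow> \<sigma>c j h \<in> tangent_space i1 M h"
    and sigma_boundary: "\<And>j h. h \<in> mbdry i1 M \<Longrightarrow> \<sigma>c j h \<in> tangent_bdry i1 M h"
  shows "\<forall>h\<in>M. \<forall>u\<in>U0 R.
    Liminf (at_right 0)
      (\<lambda>t. ereal (1/t * infdist (S t h + t *\<^sub>R (\<alpha> h - \<rho> h + \<sigma> h u)) M)) \<le> ereal (\<epsilon>1 + \<epsilon>2)"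
proof (intro ballI)
  fix h u assume h: "h \<in> M" and "u \<in> U0 R"
  then obtain z where u: "u = R z" by (auto simp: U0_def)
  obtain V \<phi> D where lp: "local_param i1 M h V \<phi> D"
    using M(1) h unfolding C1_submanifold_def by blast
  obtain y where y: "y \<in> V" "\<phi> y = h"
    using local_paramE[OF lp h] by blast
  have inj: "inj (D y)" using lp y unfolding local_param_def by blast
  define w where "w = \<sigma> h u"
  define v where "v = B h + \<alpha> h - \<rho> h"
  \<comment> \<open>The coordinates of the lineality space of the cone: the largest subspace
    contained in \<open>inward_directions i1 y\<close>.\<close>
  define X where "X = (if y $ i1 = 0 then bdry_hyperplane i1 else UNIV)"
  have X: "subspace X"
    by (simp add: X_def subspace_bdry_hyperplane)
  have "\<sigma> h (R (e j)) \<in> D y ` X" for j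
  proof -
    have "\<sigma> h (R (e j)) = \<sigma>c j h"
      using sqrt_op_eigenvector[OF R lam(3) lam(1)] g sigmac(1) by simp
    then show ?thesis
      using sigma_interior[of h j] sigma_boundary[of h j] mbdry_iff[OF lp y h] h
        tangent_space_interior[OF lp y] tangent_bdry_boundary[OF lp y]
      by (auto simp: X_def)
  qed
  then have "(\<lambda>z. \<sigma> h (R z)) ` range e \<subseteq> D y ` X" by auto
  moreover have "subspace (D y ` X)"
    using X by (intro linear_subspace_image bounded_linear.linear blinfun.bounded_linear_right)
  ultimately have "w \<in> D y ` X"
    unfolding w_def u
    using bounded_linear_range_subset_closed_subspace[OF
        L20_bounded_linear[OF sigma(1) inj_sqrt_op[OF R Q(3)]]]
      e closed_inj_blinfun_image[OF inj X]
    unfolding orthonormal_basis_def by blast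
  then obtain xw where xw: "xw \<in> X" "w = D y xw" by auto
  define K where "K = D y ` inward_directions i1 y"
  have "infdist v K \<le> \<epsilon>2"
    using drift_interior[of h] drift_boundary[of h] mbdry_iff[OF lp y h] h
      tangent_space_interior[OF lp y] tangent_halfspace_boundary[OF lp y]
    by (auto simp: K_def v_def inward_directions_def)
  have Kne: "K \<noteq> {}" by (auto simp: K_def inward_directions_def halfspace_def intro: exI[of _ 0])
  show "Liminf (at_right 0)
      (\<lambda>t. ereal (1/t * infdist (S t h + t *\<^sub>R (\<alpha> h - \<rho> h + \<sigma> h u)) M)) \<le> ereal (\<epsilon>1 + \<epsilon>2)"
  proof (rule Liminf_ereal_le_add[OF B[OF h]])
    fix \<delta> :: real assume "\<delta> > 0"
    \<comment> \<open>One half of \<open>\<delta>\<close> pays for a nearly nearest point of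
      \<open>K\<close>, the other for the difference quotient of the curve.\<close>
    then have "infdist v K < \<epsilon>2 + \<delta>/2" using \<open>infdist v K \<le> \<epsilon>2\<close> by simp
    then obtain x where x: "x \<in> inward_directions i1 y" "dist v (D y x) < \<epsilon>2 + \<delta>/2"
      using infdist_close_point[OF Kne] unfolding K_def by blast
    \<comment> \<open>At a boundary point \<open>xw\<close> has \<open>i1\<close> coordinate 0, so
      the noise direction leaves the sign of that coordinate of \<open>x\<close> unchanged.\<close>
    have "x + xw \<in> inward_directions i1 y"
      using x(1) xw(1) by (auto simp: X_def inward_directions_def halfspace_def bdry_hyperplane_def
          split: if_splits)
    note curve = local_param_curve[OF lp y(1) this]
    define c where "c t = \<phi> (y + t *\<^sub>R (x + xw))" for t
    have lim: "\<forall>\<^sub>F t in at_right 0. dist ((c t - h) /\<^sub>R t) (D y x + w) < \<delta>/2"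
      using tendstoD[OF curve(2), of "\<delta>/2"] \<open>\<delta> > 0\<close> y(2) xw(2)
      by (simp add: c_def blinfun.add_right)
    have pos: "\<forall>\<^sub>F t::real in at_right 0. t > 0" by (rule eventually_at_right_less)
    from curve(1)[folded c_def] lim pos
    show "\<forall>\<^sub>F t in at_right 0. 1/t * infdist (S t h + t *\<^sub>R (\<alpha> h - \<rho> h + \<sigma> h u)) M
        \<le> norm ((S t h - h) /\<^sub>R t - B h) + \<epsilon>2 + \<delta>"
    proof eventually_elim
      case (elim t)
      let ?p = "S t h + t *\<^sub>R (\<alpha> h - \<rho> h + \<sigma> h u)"
      let ?n1 = "(S t h - h) /\<^sub>R t - B h" and ?n2 = "v - D y x"
        and ?n3 = "D y x + w - (c t - h) /\<^sub>R t"
      \<comment> \<open>Three errors telescope: semigroup against \<open>B h\<close>, drift against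
        the cone, and velocity against the curve. The term \<open>w\<close> enters only the last and
        costs nothing in the limit.\<close>
      have "?n1 + ?n2 + ?n3 = (?p - c t) /\<^sub>R t"
        using elim(3) by (simp add: v_def w_def algebra_simps)
      have "1/t * infdist ?p M \<le> 1/t * dist ?p (c t)"
        using elim(3) infdist_le[OF elim(1)] by (intro mult_left_mono) auto
      also have "\<dots> = norm ((?p - c t) /\<^sub>R t)"
        using elim(3) by (simp add: dist_norm divide_inverse)
      also have "\<dots> = norm (?n1 + ?n2 + ?n3)"
        using \<open>?n1 + ?n2 + ?n3 = (?p - c t) /\<^sub>R t\<close> by simp
      also have "\<dots> \<le> norm ?n1 + norm ?n2 + norm ?n3"
        by (meson norm_triangle_le norm_triangle_ineq add_right_mono order_trans)
      also have "\<dots> \<le> norm ?n1 + (\<epsilon>2 + \<delta>/2) + \<delta>/2"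
        using x(2) elim(2) by (intro add_mono) (auto simp: dist_norm norm_minus_commute)
      finally show ?case by simp
    qed
  qed
qed

end
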